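(* Every real cubic equation that is not reducible by an affine change of variable to a trivial form $x^3-q=0$, $q\ge 0$, is reducible, via transformations of the types $x\mapsto\sqrt{|\alpha|}\,x$ and $x\mapsto\pm(x-\alpha)^{\pm1}$ ($\alpha\in\mathbb{R}$), to a Tusi form $x^3-x^2+q=0$ with $q\in\mathbb{R}$.
   Context: A real cubic equation is $a_3x^3+a_2x^2+a_1x+a_0=0$ with real coefficients and $a_3\neq0$. An affine change of variable is $x\mapsto cx+d$ with $c,d\in\mathbb{R}$, $c\ne0$. An equation is reducible to another via transformations of given types if the second is obtained from the first by finitely many successive substitutions, each replacing the variable $x$ by an expression of one of the types (with $\alpha\ne0$ in $\sqrt{|\alpha|}\,x$), where after each substitution one may clear denominators and multiply the equation by a nonzero real constant. *)

theory Defs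
  imports Complex_Main "HOL-Computational_Algebra.Polynomial"
begin

text \<open>
  A polynomial equation \<open>p(x) = 0\<close> is represented by the polynomial \<open>p\<close>, and a substitution
  \<open>x \<mapsto> N(x) / D(x)\<close> by the pair \<open>(N, D)\<close>.

  \<open>subst_clear p (N, D)\<close> is \<open>D ^ n * p(N / D)\<close> with \<open>n = degree p\<close> (see \<open>poly_subst_clear\<close>).
  If \<open>N\<close> and \<open>D\<close> are coprime, as they are in all substitutions below, \<open>D ^ n\<close> is exactly the
  denominator of \<open>p(N / D)\<close> in lowest terms.  For these substitutions the degree of the
  equation thus never increases, and a chain of substitutions leading from a cubic
  equation to a cubic equation passes through cubic equations only.
\<close>

definition subst_clear :: "real poly \<Rightarrow> real poly \<times> real poly \<Rightarrow> real poly" where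
  "subst_clear p = (\<lambda>(N, D). \<Sum>i\<le>degree p. smult (coeff p i) (N ^ i * D ^ (degree p - i)))"

lemma poly_subst_clear:
  assumes "poly D x \<noteq> 0"
  shows "poly (subst_clear p (N, D)) x = poly D x ^ degree p * poly p (poly N x / poly D x)"
proof -
  have "coeff p i * (poly N x ^ i * poly D x ^ (degree p - i)) =
      poly D x ^ degree p * (coeff p i * (poly N x / poly D x) ^ i)" if "i \<le> degree p" for i
    using assms that by (simp add: power_diff power_divide)
  then show ?thesis
    unfolding subst_clear_def poly_altdef[of p]
    by (auto simp: poly_sum sum_distrib_left intro!: sum.cong)
qed

lemma subst_clear_one: "subst_clear p (N, 1) = pcompose p N"
  by (simp add: subst_clear_def pcompose_altdef poly_altdef coeff_map_poly degree_map_poly)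

definition transforms_to ::
    "(real poly \<times> real poly) set \<Rightarrow> real poly \<Rightarrow> real poly \<Rightarrow> bool" where
  "transforms_to S p r \<longleftrightarrow> (\<exists>s\<in>S. \<exists>k. k \<noteq> 0 \<and> r = smult k (subst_clear p s))"

definition reducible_via ::
    "(real poly \<times> real poly) set \<Rightarrow> real poly \<Rightarrow> real poly \<Rightarrow> bool" where
  "reducible_via S = (transforms_to S)\<^sup>*\<^sup>*"

definition affine_substs :: "(real poly \<times> real poly) set" where
  "affine_substs = {([:d, c:], 1) | c d. c \<noteq> 0}"

definition scaling_substs :: "(real poly \<times> real poly) set" where
  "scaling_substs = {([:0, sqrt \<bar>\<alpha>\<bar>:], 1) | \<alpha>. \<alpha> \<noteq> 0}"

text \<open>The substitutions \<open>x - \<alpha>\<close>, \<open>-(x - \<alpha>)\<close>, \<open>1 / (x - \<alpha>)\<close> and \<open>-1 / (x - \<alpha>)\<close>:\<close>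

definition shift_inversion_substs :: "(real poly \<times> real poly) set" where
  "shift_inversion_substs =
     (\<Union>\<alpha>. {([:-\<alpha>, 1:], 1), (- [:-\<alpha>, 1:], 1), (1, [:-\<alpha>, 1:]), (- 1, [:-\<alpha>, 1:])})"

definition trivial_form :: "real \<Rightarrow> real poly" where
  "trivial_form q = [:-q, 0, 0, 1:]"

definition tusi_form :: "real \<Rightarrow> real poly" where
  "tusi_form q = [:q, 0, -1, 1:]"

end

theory Submission imports Defs
begin

text \<open>
  Shift the equation to \<open>a x\<^sup>3 + c x + d\<close>. If \<open>c = 0\<close>, it is affinely trivial. If
  \<open>c \<noteq> 0\<close> and \<open>d \<noteq> 0\<close>, the inversion \<open>x \<mapsto> 1 / x\<close> removes the linear term, and
  scaling gives a Tusi form.  There remains \<open>x\<^sup>3 + m x\<close> with \<open>m \<noteq> 0\<close>. If \<open>m < 0\<close>, shift a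
  critical point to the origin. If \<open>m > 0\<close>, there is no real critical point, but rescaling to
  \<open>x\<^sup>3 + x\<close>, shifting and inverting leads to a cubic with two real critical points.
\<close>

abbreviation tusi_substs :: "(real poly \<times> real poly) set" where
  "tusi_substs \<equiv> scaling_substs \<union> shift_inversion_substs"

lemma subst_clear_cubic:
  assumes "a \<noteq> 0"
  shows "subst_clear [:d, c, b, a:] (N, D) =
    smult d (D ^ 3) + smult c (N * D ^ 2) + smult b (N ^ 2 * D) + smult a (N ^ 3)"
  using assms by (simp add: subst_clear_def eval_nat_numeral)

lemma reducible_via_step:
  assumes "s \<in> S" "k \<noteq> 0" "r = smult k (subst_clear p s)"
  shows "reducible_via S p r"
  using assms unfolding reducible_via_def transforms_to_def by blast

lemma reducible_via_trans [trans]: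
  "reducible_via S p q \<Longrightarrow> reducible_via S q r \<Longrightarrow> reducible_via S p r"
  unfolding reducible_via_def by (rule rtranclp_trans)

lemma reducible_shift:
  assumes "a \<noteq> 0"
  shows "reducible_via tusi_substs [:d, c, b, a:]
    [:d + c * s + b * s ^ 2 + a * s ^ 3, c + 2 * b * s + 3 * a * s ^ 2, b + 3 * a * s, a:]"
proof (rule reducible_via_step)
  show "([:- (- s), 1:], 1) \<in> tusi_substs"
    unfolding shift_inversion_substs_def by blast
  show "[:d + c * s + b * s ^ 2 + a * s ^ 3, c + 2 * b * s + 3 * a * s ^ 2, b + 3 * a * s, a:] =
    smult 1 (subst_clear [:d, c, b, a:] ([:- (- s), 1:], 1))"
    using assms by (simp add: subst_clear_cubic eval_nat_numeral algebra_simps)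
qed simp

text \<open>A constant factor is only available together with a substitution, so the identity
  substitution, a shift by \<open>0\<close>, carries it.\<close>

lemma reducible_smult:
  assumes "a \<noteq> 0" "k \<noteq> 0"
  shows "reducible_via tusi_substs [:d, c, b, a:] [:k * d, k * c, k * b, k * a:]"
proof (rule reducible_via_step)
  show "([:- 0, 1:], 1) \<in> tusi_substs"
    unfolding shift_inversion_substs_def by blast
  show "[:k * d, k * c, k * b, k * a:] = smult k (subst_clear [:d, c, b, a:] ([:- 0, 1:], 1))"
    using assms by (simp add: subst_clear_cubic eval_nat_numeral)
qed (use assms in simp)

lemma reducible_reverse:
  assumes "a \<noteq> 0"
  shows "reducible_via tusi_substs [:d, c, b, a:] [:a, b, c, d:]"
proof (rule reducible_via_step)
  show "(1, [:- 0, 1:]) \<in> tusi_substs"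
    unfolding shift_inversion_substs_def by blast
  show "[:a, b, c, d:] = smult 1 (subst_clear [:d, c, b, a:] (1, [:- 0, 1:]))"
    using assms by (simp add: subst_clear_cubic eval_nat_numeral)
qed simp

lemma reducible_reflect:
  assumes "a \<noteq> 0"
  shows "reducible_via tusi_substs [:d, c, b, a:] [:d, - c, b, - a:]"
proof (rule reducible_via_step)
  show "(- [:- 0, 1:], 1) \<in> tusi_substs"
    unfolding shift_inversion_substs_def by blast
  show "[:d, - c, b, - a:] = smult 1 (subst_clear [:d, c, b, a:] (- [:- 0, 1:], 1))"
    using assms by (simp add: subst_clear_cubic eval_nat_numeral)
qed simp

lemma reducible_scale_pos:
  assumes "a \<noteq> 0" "t > 0"
  shows "reducible_via tusi_substs [:d, c, b, a:] [:d, c * t, b * t ^ 2, a * t ^ 3:]"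
proof (rule reducible_via_step)
  \<comment> \<open>Taking \<alpha> = \<open>t ^ 2\<close> turns the square root into
    \<open>t\<close>, so every positive factor is an admissible scaling.\<close>
  have "t ^ 2 \<noteq> 0"
    using assms by simp
  then have "([:0, sqrt \<bar>t ^ 2\<bar>:], 1) \<in> scaling_substs"
    unfolding scaling_substs_def by blast
  then show "([:0, t:], 1) \<in> tusi_substs"
    using assms by simp
  show "[:d, c * t, b * t ^ 2, a * t ^ 3:] = smult 1 (subst_clear [:d, c, b, a:] ([:0, t:], 1))"
    using assms by (simp add: subst_clear_cubic eval_nat_numeral)
qed simp

text \<open>Scalings provide positive factors only; for \<open>t < 0\<close>, the reflection is
  followed by scaling with \<open>- t\<close>.\<close>

lemma reducible_scale:
  assumes "a \<noteq> 0" "t \<noteq> 0"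
  shows "reducible_via tusi_substs [:d, c, b, a:] [:d, c * t, b * t ^ 2, a * t ^ 3:]"
proof (cases "t > 0")
  case True
  then show ?thesis using assms reducible_scale_pos by blast
next
  case False
  then have "reducible_via tusi_substs [:d, - c, b, - a:]
      [:d, - c * (- t), b * (- t) ^ 2, - a * (- t) ^ 3:]"
    using assms by (intro reducible_scale_pos) auto
  then have "reducible_via tusi_substs [:d, - c, b, - a:] [:d, c * t, b * t ^ 2, a * t ^ 3:]"
    by simp
  with reducible_reflect[OF assms(1)] show ?thesis
    by (rule reducible_via_trans)
qed

lemma reducible_to_tusi_no_linear:
  assumes "a \<noteq> 0" "b \<noteq> 0"
  shows "\<exists>q. reducible_via tusi_substs [:d, 0, b, a:] (tusi_form q)"
proof -
  \<comment> \<open>This \<open>t\<close> solves \<open>b * t ^ 2 = - (a * t ^ 3)\<close>, so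
    dividing by the new leading coefficient gives -1 at the quadratic term.\<close>
  define t where "t = - b / a"
  define k where "k = 1 / (a * t ^ 3)"
  have nz: "t \<noteq> 0" "k \<noteq> 0" "a * t ^ 3 \<noteq> 0"
    using assms by (auto simp: t_def k_def)
  have "reducible_via tusi_substs [:d, 0, b, a:] [:d, 0 * t, b * t ^ 2, a * t ^ 3:]"
    using assms nz by (intro reducible_scale)
  also have "reducible_via tusi_substs [:d, 0 * t, b * t ^ 2, a * t ^ 3:]
      [:k * d, k * (0 * t), k * (b * t ^ 2), k * (a * t ^ 3):]"
    using nz by (intro reducible_smult)
  also have "[:k * d, k * (0 * t), k * (b * t ^ 2), k * (a * t ^ 3):] = tusi_form (k * d)"
    using assms by (simp add: tusi_form_def k_def t_def eval_nat_numeral)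
  finally show ?thesis by blast
qed

lemma reducible_to_tusi_depressed:
  assumes "a \<noteq> 0" "c \<noteq> 0"
  shows "\<exists>q. reducible_via tusi_substs [:d, c, 0, a:] (tusi_form q)"
proof -
  have "\<exists>d' b' a'. reducible_via tusi_substs [:d, c, 0, a:] [:d', 0, b', a':] \<and>
      a' \<noteq> 0 \<and> b' \<noteq> 0"
  proof (cases "d = 0")
    case False
    then show ?thesis
      using reducible_reverse[OF assms(1)] assms by blast
  next
    case [simp]: True
    define m where "m = c / a"
    define s where "s = sqrt \<bar>m\<bar>"
    have c: "c = a * m" and "m \<noteq> 0" "s > 0" and s2: "s ^ 2 = \<bar>m\<bar>"
      using assms by (auto simp: m_def s_def)
    show ?thesis
    proof (cases "m < 0")
      case True
      \<comment> \<open>A critical point: the derivative \<open>3 * a * x ^ 2 + c\<close> vanishes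
        at \<open>u\<close>.\<close>
      define u where "u = s / sqrt 3"
      have u: "3 * u ^ 2 = - m" "u \<noteq> 0"
        using s2 \<open>s > 0\<close> True by (auto simp: u_def power_divide)
      have "c + 2 * 0 * u + 3 * a * u ^ 2 = a * (m + 3 * u ^ 2)"
        by (simp add: c algebra_simps)
      then have "c + 2 * 0 * u + 3 * a * u ^ 2 = 0" "0 + 3 * a * u \<noteq> 0"
        using u assms by auto
      with reducible_shift[OF assms(1), of d c 0 u] have
        "reducible_via tusi_substs [:d, c, 0, a:]
          [:d + c * u + 0 * u ^ 2 + a * u ^ 3, 0, 0 + 3 * a * u, a:]"
        by (simp only:)
      with assms(1) \<open>0 + 3 * a * u \<noteq> 0\<close> show ?thesis by blast
    next
      case False
      \<comment> \<open>Here \<open>m = s ^ 2\<close>, so scaling by \<open>s\<close> makes both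
        nonzero coefficients equal to \<open>a * s ^ 3\<close>.\<close>
      have "reducible_via tusi_substs [:0, c, 0, a:] [:0, c * s, 0 * s ^ 2, a * s ^ 3:]"
        using assms \<open>s > 0\<close> by (intro reducible_scale) auto
      also have "reducible_via tusi_substs [:0, c * s, 0 * s ^ 2, a * s ^ 3:]
          [:1 / (a * s ^ 3) * 0, 1 / (a * s ^ 3) * (c * s), 1 / (a * s ^ 3) * (0 * s ^ 2),
            1 / (a * s ^ 3) * (a * s ^ 3):]"
        using assms \<open>s > 0\<close> by (intro reducible_smult) auto
      also have "\<dots> = [:0, 1, 0, 1:]"
      proof -
        have "s * s = m" using s2 False by (simp add: power2_eq_square)
        then show ?thesis
          using assms \<open>s > 0\<close> by (simp add: c eval_nat_numeral)
      qed
      \<comment> \<open>After a shift by \<open>h\<close> and reversal, the derivative has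
        discriminant \<open>4 * (1 - 3 * h ^ 2)\<close>. Any \<open>h \<noteq> 0\<close> with
        \<open>3 * h ^ 2 < 1\<close> would give a cubic with two real critical points;
        \<open>h = 1/2\<close> makes them rational.\<close>
      also have "reducible_via tusi_substs [:0, 1, 0, 1:] [:5/8, 7/4, 3/2, 1:]"
        using reducible_shift[of 1 0 1 0 "1/2"] by (simp add: eval_nat_numeral)
      also have "reducible_via tusi_substs [:5/8, 7/4, 3/2, 1:] [:1, 3/2, 7/4, 5/8:]"
        by (intro reducible_reverse) simp
      \<comment> \<open>the derivative of this cubic has the roots \<open>-2/3\<close> and \<open>-6/5\<close>\<close>
      also have "reducible_via tusi_substs [:1, 3/2, 7/4, 5/8:] [:16/27, 0, 1/2, 5/8:]"
        using reducible_shift[of "5/8" 1 "3/2" "7/4" "-2/3"] by (simp add: eval_nat_numeral)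
      finally have "reducible_via tusi_substs [:d, c, 0, a:] [:16/27, 0, 1/2, 5/8:]"
        by simp
      then show ?thesis
        by (intro exI conjI) (assumption, simp_all)
    qed
  qed
  then show ?thesis
    by (blast dest: reducible_to_tusi_no_linear intro: reducible_via_trans)
qed

text \<open>The hypotheses say that the cubic is \<open>a * (x - s) ^ 3\<close> plus a constant, so
  moving \<open>s\<close> to the origin leaves a pure cube and a constant.\<close>

lemma transforms_to_trivial:
  assumes "a \<noteq> 0" "b + 3 * a * s = 0" "c + 2 * b * s + 3 * a * s ^ 2 = 0"
  shows "\<exists>q\<ge>0. transforms_to affine_substs [:d, c, b, a:] (trivial_form q)"
proof -
  define e where "e = (d + c * s + b * s ^ 2 + a * s ^ 3) / a"
  \<comment> \<open>the sign is chosen so that the constant term becomes nonpositive\<close>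
  define \<epsilon> :: real where "\<epsilon> = (if e \<le> 0 then 1 else - 1)"
  have b: "b = - 3 * a * s"
    using assms(2) by simp
  have c: "c = 3 * a * s ^ 2"
    using assms(3) by (simp add: b power2_eq_square)
  have d: "d = a * (e - s ^ 3)"
    using assms(1) by (simp add: e_def b c field_simps eval_nat_numeral)
  have eps: "\<epsilon> = 1 \<or> \<epsilon> = - 1"
    by (simp add: \<epsilon>_def)
  have "trivial_form \<bar>e\<bar> = smult (\<epsilon> / a) (subst_clear [:d, c, b, a:] ([:s, \<epsilon>:], 1))"
    using assms(1)
    by (auto simp: trivial_form_def subst_clear_cubic eval_nat_numeral b c d \<epsilon>_def
        algebra_simps)
  moreover have "([:s, \<epsilon>:], 1) \<in> affine_substs" "\<epsilon> / a \<noteq> 0"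
    using eps assms(1) by (auto simp: affine_substs_def)
  ultimately show ?thesis
    unfolding transforms_to_def by (metis abs_ge_zero)
qed

theorem theorem3:
  fixes p :: "real poly"
  assumes "degree p = 3"
    and "\<not> (\<exists>q\<ge>0. transforms_to affine_substs p (trivial_form q))"
  shows "\<exists>q. reducible_via (scaling_substs \<union> shift_inversion_substs) p (tusi_form q)"
proof -
  obtain a b c d where p: "p = [:d, c, b, a:]" and a: "a \<noteq> 0"
  proof
    show "p = [:coeff p 0, coeff p 1, coeff p 2, coeff p 3:]"
      using assms(1) by (intro poly_eqI)
        (auto simp: coeff_pCons coeff_eq_0 eval_nat_numeral split: nat.split)
    show "coeff p 3 \<noteq> 0"
      using assms(1) by (metis leading_coeff_0_iff degree_0 zero_neq_numeral)
  qed
  \<comment> \<open>The inflection point: shifting it to the origin removes the quadratic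
    term.\<close>
  define s where "s = - b / (3 * a)"
  have s: "b + 3 * a * s = 0"
    using a by (simp add: s_def)
  \<comment> \<open>If the linear coefficient vanished after this shift, the equation would be
    affinely trivial.\<close>
  have "c + 2 * b * s + 3 * a * s ^ 2 \<noteq> 0"
    using transforms_to_trivial[OF a s] assms(2) p by blast
  with reducible_shift[OF a, of d c b s] show ?thesis
    using reducible_to_tusi_depressed[OF a] unfolding p s
    by (blast intro: reducible_via_trans)
qed

end
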